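(* Endow $\mathbb R^2$ with the standard coordinate system $(x,y)$. Let $\alpha>1$ and let $X:=\partial_x$ and $Y:=xf(y)\partial_x+\partial_y$, where $f(y):=\alpha\max(0,y)^{\alpha-1}$. Then there is a $\mathcal C^{\alpha+1}$ atlas $\mathscr A$ on $\mathbb R^2$, compatible with the standard $\mathcal C^\alpha$ structure on $\mathbb R^2$, such that $X,Y$ are $\mathcal C^\alpha_{\mathrm{loc}}$ with respect to $\mathscr A$, but for the canonical coordinates $\Phi(t,s):=e^{tX+sY}(0)$ we have, for every $\varepsilon>0$, that $\Phi^*Y$ is not $\mathcal C^{\alpha-1+\varepsilon}$ near $(t,s)=(0,0)$; in particular, the collection $(\Phi^*X,\Phi^*Y)$ is not $\mathcal C^{\alpha-1+\varepsilon}$ near $(0,0)$.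
   Context: $\mathcal C^s(U)=B^s_{\infty,\infty}(U)$ denotes the Zygmund–Hölder space of order $s$ (equal to the Hölder space $C^{m,r}$ when $s=m+r$, $m\in\mathbb N$, $r\in(0,1)$); $\mathcal C^s_{\mathrm{loc}}(U)$ consists of distributions $f$ on the open set $U$ such that every point of $U$ lies in an open ball $U'\subseteq U$ with $f|_{U'}\in\mathcal C^s(U')$. A vector field is $\mathcal C^s$ if its coefficients are. A $\mathcal C^{\alpha+1}$ atlas has $\mathcal C^{\alpha+1}_{\mathrm{loc}}$ transition maps; it is compatible with the standard $\mathcal C^\alpha$ structure if its charts and their inverses are $\mathcal C^\alpha_{\mathrm{loc}}$ in the standard coordinates. $e^{tX+sY}(0)=E(1)$, where $E:[0,1]\to\mathbb R^2$ solves $E'(r)=tX(E(r))+sY(E(r))$, $E(0)=0$; $\Phi(t,s)$ is defined for $(t,s)$ near $(0,0)$. *)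

theory Defs
  imports "HOL-Analysis.Analysis"
begin

text \<open>
  Zygmund--Hoelder spaces of order s > 0. Elements of B^s_{oo,oo} with s > 0 are (represented by)
  continuous functions, so functions rather than distributions are used. We use the classical
  description: write s = m + r with m a natural number and 0 < r <= 1 (this determines m and r).
  All derivatives of order at most m are bounded, and those of order m are Hoelder continuous
  with exponent r if r < 1 (so that the space is the Hoelder space C^{m,r}), and satisfy Zygmund's
  second difference condition if r = 1. On balls, the only sets on which the space is used below,
  this is B^s_{oo,oo} for every s > 0.
\<close>

primrec zh_class :: "nat \<Rightarrow> real \<Rightarrow> 'a::euclidean_space set \<Rightarrow> ('a \<Rightarrow> real) \<Rightarrow> bool" where
  "zh_class 0 r U f \<longleftrightarrow> bounded (f ` U) \<and> continuous_on U f \<and>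
     (if r < 1
      then \<exists>C. \<forall>x\<in>U. \<forall>y\<in>U. \<bar>f x - f y\<bar> \<le> C * norm (x - y) powr r
      else \<exists>C. \<forall>x h. x \<in> U \<and> x + h \<in> U \<and> x - h \<in> U \<longrightarrow>
                 \<bar>f (x + h) + f (x - h) - 2 * f x\<bar> \<le> C * norm h)"
| "zh_class (Suc m) r U f \<longleftrightarrow> bounded (f ` U) \<and> (\<forall>x\<in>U. f differentiable (at x)) \<and>
     (\<forall>b\<in>Basis. zh_class m r U (\<lambda>x. frechet_derivative f (at x) b))"

definition zygmund_holder :: "real \<Rightarrow> 'a::euclidean_space set \<Rightarrow> ('a \<Rightarrow> real) \<Rightarrow> bool" where
  "zygmund_holder s U f \<longleftrightarrow>
     (\<exists>m r. s = real m + r \<and> 0 < r \<and> r \<le> 1 \<and> zh_class m r U f)"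

definition zygmund_holder_loc :: "real \<Rightarrow> 'a::euclidean_space set \<Rightarrow> ('a \<Rightarrow> real) \<Rightarrow> bool" where
  "zygmund_holder_loc s U f \<longleftrightarrow>
     (\<forall>x\<in>U. \<exists>c e. x \<in> ball c e \<and> ball c e \<subseteq> U \<and> zygmund_holder s (ball c e) f)"

text \<open>Maps between Euclidean spaces, and vector fields: all components are of the given class.\<close>

definition zh_loc_map ::
    "real \<Rightarrow> 'a::euclidean_space set \<Rightarrow> ('a \<Rightarrow> 'b::euclidean_space) \<Rightarrow> bool" where
  "zh_loc_map s U F \<longleftrightarrow> (\<forall>b\<in>Basis. zygmund_holder_loc s U (\<lambda>x. F x \<bullet> b))"

text \<open>A chart is a pair of its domain and its coordinate map; the values of the map outside the
  domain are irrelevant.\<close>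

type_synonym 'a chart = "'a set \<times> ('a \<Rightarrow> 'a)"

definition is_chart :: "'a::euclidean_space chart \<Rightarrow> bool" where
  "is_chart = (\<lambda>(U, \<phi>). open U \<and> open (\<phi> ` U) \<and> homeomorphism U (\<phi> ` U) \<phi> (inv_into U \<phi>))"

definition zh_atlas :: "real \<Rightarrow> 'a::euclidean_space chart set \<Rightarrow> bool" where
  "zh_atlas s \<A> \<longleftrightarrow>
     (\<forall>c\<in>\<A>. is_chart c) \<and>
     (\<Union>(U, \<phi>)\<in>\<A>. U) = UNIV \<and>
     (\<forall>(U, \<phi>)\<in>\<A>. \<forall>(V, \<psi>)\<in>\<A>. zh_loc_map s (\<phi> ` (U \<inter> V)) (\<psi> \<circ> inv_into U \<phi>))"

definition compatible_with_standard :: "real \<Rightarrow> 'a::euclidean_space chart set \<Rightarrow> bool" where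
  "compatible_with_standard s \<A> \<longleftrightarrow>
     (\<forall>(U, \<phi>)\<in>\<A>. zh_loc_map s U \<phi> \<and> zh_loc_map s (\<phi> ` U) (inv_into U \<phi>))"

text \<open>The vector field \<open>V\<close>, given in standard coordinates, expressed in a chart. This is
  meaningful for differentiable charts, such as those of class C^s with s > 1.\<close>

definition in_chart :: "'a::euclidean_space chart \<Rightarrow> ('a \<Rightarrow> 'a) \<Rightarrow> 'a \<Rightarrow> 'a" where
  "in_chart = (\<lambda>(U, \<phi>) V q.
     frechet_derivative \<phi> (at (inv_into U \<phi> q)) (V (inv_into U \<phi> q)))"

definition zh_field_wrt :: "real \<Rightarrow> 'a::euclidean_space chart set \<Rightarrow> ('a \<Rightarrow> 'a) \<Rightarrow> bool" where
  "zh_field_wrt s \<A> V \<longleftrightarrow> (\<forall>(U, \<phi>)\<in>\<A>. zh_loc_map s (\<phi> ` U) (in_chart (U, \<phi>) V))"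

definition flows_to :: "('a::euclidean_space \<Rightarrow> 'a) \<Rightarrow> 'a \<Rightarrow> 'a \<Rightarrow> bool" where
  "flows_to V p q \<longleftrightarrow>
     (\<exists>E. (\<forall>r\<in>{0..1}. (E has_vector_derivative V (E r)) (at r within {0..1})) \<and>
          E 0 = p \<and> E 1 = q)"

text \<open>\<open>e^V(p)\<close>; meaningful when there is exactly one \<open>q\<close> with \<open>flows_to V p q\<close>.\<close>

definition exp_field :: "('a::euclidean_space \<Rightarrow> 'a) \<Rightarrow> 'a \<Rightarrow> 'a" where
  "exp_field V p = (THE q. flows_to V p q)"

text \<open>Injective C^1 maps with everywhere invertible derivative; by the inverse function theorem
  these are the C^1 diffeomorphisms onto an open image.\<close>

definition C1_diffeo_on :: "'a::euclidean_space set \<Rightarrow> ('a \<Rightarrow> 'a) \<Rightarrow> bool" where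
  "C1_diffeo_on U \<Phi> \<longleftrightarrow> open U \<and> inj_on \<Phi> U \<and>
     (\<forall>p\<in>U. \<Phi> differentiable (at p) \<and> bij (frechet_derivative \<Phi> (at p))) \<and>
     (\<forall>b\<in>Basis. continuous_on U (\<lambda>p. frechet_derivative \<Phi> (at p) b))"

text \<open>The pullback of a vector field; meaningful where \<open>\<Phi>\<close> has an invertible derivative.\<close>

definition pullback_field :: "('a::euclidean_space \<Rightarrow> 'a) \<Rightarrow> ('a \<Rightarrow> 'a) \<Rightarrow> 'a \<Rightarrow> 'a" where
  "pullback_field \<Phi> V p = inv (frechet_derivative \<Phi> (at p)) (V (\<Phi> p))"

end

theory Submission
  imports Defs "HOL-Computational_Algebra.Polynomial"
begin

text \<open>
  Let \<open>F(y) = max(0,y)^\<alpha>\<close>, so that \<open>F' = f\<close>. The single global chart \<open>(u,v) = (x e^{-F(y)}, y)\<close> is of class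
  \<open>C^\<alpha>\<close> and straightens \<open>Y\<close>: in it \<open>Y = \<partial>_v\<close> and \<open>X = e^{-F(v)} \<partial>_u\<close>. On the other hand,
  solving the linear flow equation with the integrating factor \<open>e^{-F}\<close> gives
  \<open>\<Phi>(t,s) = (t e^{F(s)} h(s), s)\<close> with \<open>h(s)\<close> the integral of \<open>e^{-F(su)}\<close> over \<open>u \<in> [0,1]\<close>, whence
  \<open>\<Phi>^*Y = (- t h'(s)/h(s), 1)\<close>. The first component vanishes for \<open>s \<le> 0\<close> and is at least a constant
  times \<open>t s^{\<alpha>-1}\<close> for small \<open>s > 0\<close>, while a function of class \<open>C^\<sigma>\<close> that vanishes on a half plane
  is \<open>O(s^\<sigma>)\<close> across its boundary.
\<close>

subsection \<open>Powers of the positive part\<close>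

text \<open>Since \<open>0 powr b = 0\<close> for every \<open>b\<close>, this vanishes on
  \<open>y \<le> 0\<close> whatever the exponent, even for \<open>b \<le> 0\<close>, and
  \<open>pos_pow_add\<close> needs no condition on the exponents.\<close>

definition pos_pow :: "real \<Rightarrow> real \<Rightarrow> real" where
  "pos_pow b y = max 0 y powr b"

lemma pos_pow_nonneg [simp]: "0 \<le> pos_pow b y"
  by (simp add: pos_pow_def)

lemma pos_pow_nonpos [simp]: "y \<le> 0 \<Longrightarrow> pos_pow b y = 0"
  by (simp add: pos_pow_def)

lemma pos_pow_add: "pos_pow a y * pos_pow b y = pos_pow (a + b) y"
  by (simp add: pos_pow_def powr_add)

lemma continuous_on_pos_pow [continuous_intros]:
  assumes "0 < b" "continuous_on S g"
  shows "continuous_on S (\<lambda>x. pos_pow b (g x))"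
  unfolding pos_pow_def using assms
  by (intro continuous_on_powr' continuous_intros) auto

lemma has_real_derivative_pos_pow:
  assumes "1 < b"
  shows "(pos_pow b has_real_derivative b * pos_pow (b - 1) y) (at y)"
proof -
  consider "y < 0" | "y = 0" | "0 < y" by linarith
  then show ?thesis
  proof cases
    case 1
    have "((\<lambda>_. 0) has_real_derivative b * pos_pow (b - 1) y) (at y)"
      using 1 by simp
    then show ?thesis
      by (rule has_field_derivative_transform_within_open[where S = "{..<0}"]) (use 1 in auto)
  next
    case 3
    have "((\<lambda>y. y powr b) has_real_derivative b * y powr (b - 1)) (at y)"
      using 3 by (auto intro!: derivative_eq_intros)
    moreover have "b * y powr (b - 1) = b * pos_pow (b - 1) y"
      using 3 by (simp add: pos_pow_def)
    ultimately have "((\<lambda>y. y powr b) has_real_derivative b * pos_pow (b - 1) y) (at y)"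
      by simp
    then show ?thesis
      by (rule has_field_derivative_transform_within_open[where S = "{0<..}"])
        (use 3 in \<open>auto simp: pos_pow_def\<close>)
  next
    case 2
    have "isCont (pos_pow (b - 1)) 0"
      using continuous_on_pos_pow[of "b - 1" UNIV "\<lambda>x. x"] assms
      by (simp add: continuous_on_eq_continuous_at)
    then have "(pos_pow (b - 1) \<longlongrightarrow> 0) (at 0)"
      by (simp add: isCont_def)
    \<comment> \<open>The difference quotient at 0 is \<open>pos_pow (b - 1)\<close> itself, even at
      \<open>h = 0\<close>, where division by zero gives 0; continuity of that function then yields
      the derivative.\<close>
    moreover have "pos_pow (b - 1) = (\<lambda>h. (pos_pow b h - pos_pow b 0) / (h - 0))"
    proof
      fix h
      show "pos_pow (b - 1) h = (pos_pow b h - pos_pow b 0) / (h - 0)"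
      proof (cases "h > 0")
        case True
        then have "h powr b = h * h powr (b - 1)"
          by (simp add: powr_diff)
        then show ?thesis using True by (simp add: pos_pow_def)
      qed simp
    qed
    ultimately have "((\<lambda>h. (pos_pow b h - pos_pow b 0) / (h - 0)) \<longlongrightarrow> 0) (at 0)"
      by (simp only:)
    then show ?thesis
      by (simp only: has_field_derivative_iff 2) simp
  qed
qed

lemmas has_real_derivative_pos_pow_compose [derivative_intros] =
  DERIV_chain2[OF has_real_derivative_pos_pow]

lemma abs_diff_pos_pow_le:
  assumes "0 < r" "r \<le> 1"
  shows "\<bar>pos_pow r x - pos_pow r y\<bar> \<le> \<bar>x - y\<bar> powr r"
proof -
  \<comment> \<open>Subadditivity of the power: on [0,1] one has \<open>x \<le> x powr r\<close>
    because r \<le> 1. This is applied to the fractions \<open>b / a\<close> and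
    \<open>(a - b) / a\<close>, which add up to 1.\<close>
  have sub: "a powr r \<le> b powr r + (a - b) powr r" if "0 \<le> b" "b \<le> a" for a b :: real
  proof (cases "a = 0")
    case False
    have *: "x \<le> x powr r" if "0 \<le> x" "x \<le> 1" for x :: real
      using powr_mono'[of r 1 x] that assms by (cases "x = 0") auto
    have "1 = b / a + (a - b) / a"
      using False by (simp add: field_simps)
    also have "\<dots> \<le> (b / a) powr r + ((a - b) / a) powr r"
      using that False by (intro add_mono *) auto
    also have "\<dots> = (b powr r + (a - b) powr r) / a powr r"
      using that by (simp add: powr_divide add_divide_distrib)
    finally show ?thesis
      using that False by (simp add: pos_le_divide_eq)
  qed (use that in simp)
  have mono: "0 \<le> pos_pow r a - pos_pow r b \<and> pos_pow r a - pos_pow r b \<le> (a - b) powr r"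
    if "b \<le> a" for a b
  proof
    show "0 \<le> pos_pow r a - pos_pow r b"
      using that assms by (simp add: pos_pow_def powr_mono2)
    have "pos_pow r a - pos_pow r b \<le> (max 0 a - max 0 b) powr r"
      using sub[of "max 0 b" "max 0 a"] that by (simp add: pos_pow_def max.coboundedI2)
    also have "\<dots> \<le> (a - b) powr r"
      using that assms by (intro powr_mono2) auto
    finally show "pos_pow r a - pos_pow r b \<le> (a - b) powr r" .
  qed
  show ?thesis
    using mono[of x y] mono[of y x] by (cases "x \<le> y") auto
qed

text \<open>As p \<ge> 1, the derivative is largest at the right end \<open>M\<close>. The mean
  value theorem asks for differentiability only in the open interval, so the endpoint 0 is
  harmless.\<close>

lemma lipschitz_on_powr:
  assumes "1 \<le> p" "0 \<le> M"
  shows "(p * M powr (p - 1))-lipschitz_on {0..M} (\<lambda>z::real. z powr p)"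
proof (rule lipschitz_onI)
  have *: "\<bar>w powr p - z powr p\<bar> \<le> p * M powr (p - 1) * \<bar>w - z\<bar>"
    if zw: "0 \<le> z" "z < w" "w \<le> M" for z w
  proof -
    obtain l u where u: "z < u" "u < w" "DERIV (\<lambda>z. z powr p) u :> l"
      and eq: "w powr p - z powr p = (w - z) * l"
    proof (rule MVT[of z w "\<lambda>z. z powr p", THEN exE])
      show "continuous_on {z..w} (\<lambda>z. z powr p)"
        using zw assms by (intro continuous_on_powr' continuous_intros) auto
      show "(\<lambda>z. z powr p) differentiable (at x)" if "z < x" for x
        using that \<open>0 \<le> z\<close> by (intro differentiableI[of _ "\<lambda>h. p * x powr (p - 1) * h"])
          (auto intro!: derivative_eq_intros simp: powr_diff field_simps)
    qed (use zw that in blast)+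
    have "DERIV (\<lambda>z. z powr p) u :> p * u powr (p - 1)"
      using u zw by (auto intro!: derivative_eq_intros)
    then have "l = p * u powr (p - 1)"
      using u(3) DERIV_unique by blast
    moreover have "u powr (p - 1) \<le> M powr (p - 1)"
      using u zw assms by (intro powr_mono2) auto
    ultimately have "\<bar>l\<bar> \<le> p * M powr (p - 1)"
      using assms by (simp add: abs_mult)
    then show ?thesis
      using mult_right_mono[of "\<bar>l\<bar>" "p * M powr (p - 1)" "\<bar>w - z\<bar>"]
      by (simp add: eq abs_mult mult_ac)
  qed
  fix x y assume "x \<in> {0..M}" "y \<in> {0..M}"
  then show "dist (x powr p) (y powr p) \<le> p * M powr (p - 1) * dist x y"
    using *[of x y] *[of y x] by (cases x y rule: linorder_cases) (auto simp: dist_real_def)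
qed (use assms in simp)

subsection \<open>Hoelder functions\<close>

text \<open>Unlike in \<open>zh_class 0\<close>, exponent 1 means Lipschitz here, not Zygmund. This
  stronger condition passes to products on bounded sets and to Lipschitz compositions by elementary
  estimates, and every membership in a class is derived from it.\<close>

definition hoelder_on :: "real \<Rightarrow> 'a::real_normed_vector set \<Rightarrow> ('a \<Rightarrow> real) \<Rightarrow> bool" where
  "hoelder_on r U f \<longleftrightarrow> (\<exists>C\<ge>0. \<forall>x\<in>U. \<forall>y\<in>U. \<bar>f x - f y\<bar> \<le> C * norm (x - y) powr r)"

lemma hoelder_onI:
  assumes "0 \<le> C" "\<And>x y. x \<in> U \<Longrightarrow> y \<in> U \<Longrightarrow> \<bar>f x - f y\<bar> \<le> C * norm (x - y) powr r"
  shows "hoelder_on r U f"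
  using assms by (auto simp: hoelder_on_def)

lemma hoelder_on_bounded_image:
  assumes f: "hoelder_on r U f" and "bounded U" "0 < r"
  shows "bounded (f ` U)"
proof (cases "U = {}")
  case False
  then obtain a where a: "a \<in> U" by blast
  obtain C where C: "0 \<le> C" "\<And>x y. x \<in> U \<Longrightarrow> y \<in> U \<Longrightarrow> \<bar>f x - f y\<bar> \<le> C * norm (x - y) powr r"
    using f by (auto simp: hoelder_on_def)
  obtain B where B: "\<And>x. x \<in> U \<Longrightarrow> dist a x \<le> B"
    using \<open>bounded U\<close> bounded_any_center[of U a] by auto
  have "\<bar>f a - f x\<bar> \<le> C * B powr r" if "x \<in> U" for x
  proof -
    have "\<bar>f a - f x\<bar> \<le> C * norm (a - x) powr r"
      using C a that by blast
    also have "\<dots> \<le> C * B powr r"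
      using C B[OF that] \<open>0 < r\<close> by (intro mult_left_mono powr_mono2) (auto simp: dist_norm)
    finally show ?thesis .
  qed
  then show ?thesis
    unfolding bounded_def by (auto simp: dist_real_def)
qed simp

lemma hoelder_on_imp_continuous_on:
  assumes f: "hoelder_on r U f" and "0 < r"
  shows "continuous_on U f"
  unfolding continuous_on_def
proof
  obtain C where C: "0 \<le> C" "\<And>x y. x \<in> U \<Longrightarrow> y \<in> U \<Longrightarrow> \<bar>f x - f y\<bar> \<le> C * norm (x - y) powr r"
    using f by (auto simp: hoelder_on_def)
  fix a assume a: "a \<in> U"
  have "continuous_on UNIV (\<lambda>x. C * norm (x - a) powr r)"
    using \<open>0 < r\<close> by (intro continuous_intros continuous_on_powr') auto
  then have "((\<lambda>x. C * norm (x - a) powr r) \<longlongrightarrow> C * norm (a - a) powr r) (at a)"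
    unfolding continuous_on_def by blast
  then have lim: "((\<lambda>x. C * norm (x - a) powr r) \<longlongrightarrow> 0) (at a within U)"
    using at_le[of U UNIV] by (auto intro: tendsto_mono)
  have "((\<lambda>x. f x - f a) \<longlongrightarrow> 0) (at a within U)"
    by (rule Lim_null_comparison[OF _ lim]) (use a C in \<open>auto simp: eventually_at_filter\<close>)
  then show "(f \<longlongrightarrow> f a) (at a within U)"
    by (simp add: LIM_zero_iff)
qed

lemma hoelder_on_mult:
  assumes f: "hoelder_on r U f" and g: "hoelder_on r U g" and "bounded U" "0 < r"
  shows "hoelder_on r U (\<lambda>x. f x * g x)"
proof -
  obtain C where C: "0 \<le> C" "\<And>x y. x \<in> U \<Longrightarrow> y \<in> U \<Longrightarrow> \<bar>f x - f y\<bar> \<le> C * norm (x - y) powr r"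
    using f by (auto simp: hoelder_on_def)
  obtain D where D: "0 \<le> D" "\<And>x y. x \<in> U \<Longrightarrow> y \<in> U \<Longrightarrow> \<bar>g x - g y\<bar> \<le> D * norm (x - y) powr r"
    using g by (auto simp: hoelder_on_def)
  obtain A where A: "A > 0" "\<And>x. x \<in> U \<Longrightarrow> \<bar>f x\<bar> \<le> A"
    using hoelder_on_bounded_image[OF f assms(3,4)] by (auto simp: bounded_pos)
  obtain B where B: "B > 0" "\<And>x. x \<in> U \<Longrightarrow> \<bar>g x\<bar> \<le> B"
    using hoelder_on_bounded_image[OF g assms(3,4)] by (auto simp: bounded_pos)
  show ?thesis
  proof (rule hoelder_onI[of "A * D + C * B"])
    fix x y assume xy: "x \<in> U" "y \<in> U"
    have "f x * g x - f y * g y = f x * (g x - g y) + (f x - f y) * g y"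
      by (simp add: algebra_simps)
    then have "\<bar>f x * g x - f y * g y\<bar> \<le> \<bar>f x\<bar> * \<bar>g x - g y\<bar> + \<bar>f x - f y\<bar> * \<bar>g y\<bar>"
      by (metis abs_mult abs_triangle_ineq)
    also have "\<dots> \<le> A * (D * norm (x - y) powr r) + (C * norm (x - y) powr r) * B"
      using A B C D xy by (intro add_mono mult_mono) auto
    finally show "\<bar>f x * g x - f y * g y\<bar> \<le> (A * D + C * B) * norm (x - y) powr r"
      by (simp add: algebra_simps)
  qed (use A B C D in simp)
qed

lemma hoelder_on_lipschitz_compose:
  assumes f: "hoelder_on r U f" and g: "L-lipschitz_on (f ` U) g"
  shows "hoelder_on r U (\<lambda>x. g (f x))"
proof -
  obtain C where C: "0 \<le> C" "\<And>x y. x \<in> U \<Longrightarrow> y \<in> U \<Longrightarrow> \<bar>f x - f y\<bar> \<le> C * norm (x - y) powr r"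
    using f by (auto simp: hoelder_on_def)
  have L: "0 \<le> L" using g lipschitz_on_nonneg by blast
  show ?thesis
  proof (rule hoelder_onI[of "L * C"])
    fix x y assume xy: "x \<in> U" "y \<in> U"
    have "\<bar>g (f x) - g (f y)\<bar> \<le> L * \<bar>f x - f y\<bar>"
      using lipschitz_onD[OF g, of "f x" "f y"] xy by (auto simp: dist_real_def)
    also have "\<dots> \<le> L * (C * norm (x - y) powr r)"
      using C xy L by (intro mult_left_mono) auto
    finally show "\<bar>g (f x) - g (f y)\<bar> \<le> L * C * norm (x - y) powr r"
      by (simp add: mult.assoc)
  qed (use L C in simp)
qed

lemma lipschitz_on_imp_hoelder_on:
  assumes f: "L-lipschitz_on U f" and "bounded U" "0 < r" "r \<le> 1"
  shows "hoelder_on r U f"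
proof -
  have L: "0 \<le> L" using f lipschitz_on_nonneg by blast
  obtain B where B: "\<And>x y. x \<in> U \<Longrightarrow> y \<in> U \<Longrightarrow> norm (x - y) \<le> B" 
    using \<open>bounded U\<close> by (metis bounded_two_points dist_norm)
  show ?thesis
  proof (rule hoelder_onI[of "L * B powr (1 - r)"])
    fix x y assume xy: "x \<in> U" "y \<in> U"
    have "\<bar>f x - f y\<bar> \<le> L * norm (x - y)"
      using lipschitz_onD[OF f, of x y] xy by (auto simp: dist_norm)
    \<comment> \<open>Splitting off the nonnegative exponent \<open>1 - r\<close> leaves a factor
      controlled by the diameter bound \<open>B\<close>.\<close>
    also have "norm (x - y) = norm (x - y) powr (1 - r) * norm (x - y) powr r"
      by (simp flip: powr_add)
    also have "L * \<dots> \<le> L * (B powr (1 - r) * norm (x - y) powr r)"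
      using L B[OF xy] assms by (intro mult_left_mono mult_right_mono powr_mono2) auto
    finally show "\<bar>f x - f y\<bar> \<le> L * B powr (1 - r) * norm (x - y) powr r"
      by (simp add: mult.assoc)
  qed (use L in simp)
qed

lemma hoelder_on_affine:
  fixes v :: "'a::real_inner"
  assumes "bounded U" "0 < r" "r \<le> 1"
  shows "hoelder_on r U (\<lambda>p. c + p \<bullet> v)"
proof (rule lipschitz_on_imp_hoelder_on[OF _ assms])
  show "(norm v)-lipschitz_on U (\<lambda>p. c + p \<bullet> v)"
  proof (rule lipschitz_onI)
    fix x y
    have "c + x \<bullet> v - (c + y \<bullet> v) = (x - y) \<bullet> v"
      by (simp add: inner_diff_left)
    then show "dist (c + x \<bullet> v) (c + y \<bullet> v) \<le> norm v * dist x y"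
      using Cauchy_Schwarz_ineq2[of "x - y" v] by (simp add: dist_norm mult.commute)
  qed simp
qed

section \<open>From Hoelder bounds to Zygmund-Hoelder classes\<close>

lemma hoelder_on_imp_zh_class_0:
  assumes f: "hoelder_on r U f" and U: "bounded U" "0 < r" "r \<le> 1"
  shows "zh_class 0 r U f"
proof -
  obtain C where C: "0 \<le> C" "\<And>x y. x \<in> U \<Longrightarrow> y \<in> U \<Longrightarrow> \<bar>f x - f y\<bar> \<le> C * norm (x - y) powr r"
    using f by (auto simp: hoelder_on_def)
  \<comment> \<open>For r = 1 the second difference is a sum of two first differences from the
    centre \<open>x\<close>, each at most \<open>C * norm h\<close>.\<close>
  have "\<bar>f (x + h) + f (x - h) - 2 * f x\<bar> \<le> (2 * C) * norm h"
    if "r = 1" "x \<in> U" "x + h \<in> U" "x - h \<in> U" for x h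
    using C(2)[of "x + h" x] C(2)[of "x - h" x] that by simp
  then have "\<exists>C. \<forall>x h. x \<in> U \<and> x + h \<in> U \<and> x - h \<in> U \<longrightarrow>
                 \<bar>f (x + h) + f (x - h) - 2 * f x\<bar> \<le> C * norm h" if "r = 1"
    using that by blast
  then show ?thesis
    using hoelder_on_bounded_image[OF f] hoelder_on_imp_continuous_on[OF f] C(2) U
    by (auto intro!: exI[of _ C])
qed

text \<open>The derivative along \<open>b\<close> is the constant \<open>b \<bullet> v\<close>,
  again affine but with vector 0, so the induction has to cover all \<open>c\<close> and
  \<open>v\<close>.\<close>

lemma zh_class_affine:
  assumes "bounded U" "0 < r" "r \<le> 1"
  shows "zh_class m r U (\<lambda>p. c + p \<bullet> v)"
proof (induction m arbitrary: c v)
  case 0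
  show ?case
    using assms by (intro hoelder_on_imp_zh_class_0 hoelder_on_affine)
next
  case (Suc m)
  have D: "((\<lambda>p. c + p \<bullet> v) has_derivative (\<lambda>h. h \<bullet> v)) (at x)" for x
    by (auto intro!: derivative_eq_intros)
  have "frechet_derivative (\<lambda>p. c + p \<bullet> v) (at x) = (\<lambda>h. h \<bullet> v)" for x
    using frechet_derivative_at[OF D] by simp
  moreover have "zh_class m r U (\<lambda>x. b \<bullet> v)" for b
    using Suc[of "b \<bullet> v" 0] by simp
  moreover have "bounded ((\<lambda>p. c + p \<bullet> v) ` U)"
    using hoelder_on_bounded_image[OF hoelder_on_affine] assms by blast
  ultimately show ?case
    using D by (auto simp: differentiable_def)
qed

lemma zygmund_holder_locI:
  fixes f :: "'a::euclidean_space \<Rightarrow> real"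
  assumes "s = real m + r" "0 < r" "r \<le> 1" "\<And>U. bounded U \<Longrightarrow> zh_class m r U f"
  shows "zygmund_holder_loc s UNIV f"
  unfolding zygmund_holder_loc_def zygmund_holder_def
proof
  fix x :: 'a
  have "zh_class m r (ball x 1) f" using assms by simp
  then show "\<exists>c e. x \<in> ball c e \<and> ball c e \<subseteq> UNIV \<and>
      (\<exists>m r. s = real m + r \<and> 0 < r \<and> r \<le> 1 \<and> zh_class m r (ball c e) f)"
    using assms by (intro exI[of _ x] exI[of _ 1]) auto
qed

lemma zh_order_decomposition:
  fixes s :: real
  assumes "0 < s"
  obtains m r where "s = real m + r" "0 < r" "r \<le> 1"
proof
  \<comment> \<open>The ceiling minus one replaces the floor because for integer \<open>s\<close>
    the remainder must be 1, not 0.\<close>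
  define k where "k = \<lceil>s\<rceil> - 1"
  have "0 \<le> k" using assms unfolding k_def by (simp add: le_diff_eq)
  then show "s = real (nat k) + (s - k)" by simp
  show "0 < s - k" "s - k \<le> 1" unfolding k_def by linarith+
qed

lemma zygmund_holder_loc_affine:
  assumes "0 < s"
  shows "zygmund_holder_loc s UNIV (\<lambda>p. c + p \<bullet> v)"
  using zh_order_decomposition[OF assms] zygmund_holder_locI zh_class_affine by metis

section \<open>Regularity of powers and exponentials of the positive part\<close>

lemma hoelder_on_pos_pow:
  assumes g: "1-lipschitz_on U g" and U: "bounded U" and r: "0 < r" "r \<le> 1" "r \<le> b"
  shows "hoelder_on r U (\<lambda>p. pos_pow b (g p))"
proof -
  have h: "hoelder_on r U (\<lambda>p. pos_pow r (g p))"
  proof (rule hoelder_onI[of 1])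
    fix x y assume xy: "x \<in> U" "y \<in> U"
    have "\<bar>pos_pow r (g x) - pos_pow r (g y)\<bar> \<le> \<bar>g x - g y\<bar> powr r"
      using r by (intro abs_diff_pos_pow_le)
    also have "\<dots> \<le> norm (x - y) powr r"
      using lipschitz_onD[OF g xy] r by (intro powr_mono2) (auto simp: dist_norm)
    finally show "\<bar>pos_pow r (g x) - pos_pow r (g y)\<bar> \<le> 1 * norm (x - y) powr r" by simp
  qed simp
  obtain M where M: "0 < M" "\<And>p. p \<in> U \<Longrightarrow> pos_pow r (g p) \<le> M"
    using hoelder_on_bounded_image[OF h U r(1)] by (auto simp: bounded_pos)
  \<comment> \<open>\<open>pos_pow b\<close> is the power \<open>b / r\<close> \<ge> 1 of
    \<open>pos_pow r\<close>: an r-Hoelder function followed by one that is Lipschitz on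
    \<open>{0..M}\<close>.\<close>
  have "(b / r * M powr (b / r - 1))-lipschitz_on ((\<lambda>p. pos_pow r (g p)) ` U) (\<lambda>z. z powr (b / r))"
    by (rule lipschitz_on_subset[OF lipschitz_on_powr[of "b / r" M]]) (use M r in auto)
  from hoelder_on_lipschitz_compose[OF h this] show ?thesis
    using r by (simp add: pos_pow_def powr_powr)
qed

lemma C1_imp_lipschitz_on_interval:
  fixes f f' :: "real \<Rightarrow> real"
  assumes "\<And>x. (f has_real_derivative f' x) (at x)" and "continuous_on {a..b} f'"
  obtains L where "L-lipschitz_on {a..b} f"
proof -
  have "bounded (f' ` {a..b})"
    using assms(2) by (simp add: compact_continuous_image compact_imp_bounded)
  then obtain L where L: "0 < L" "\<And>x. x \<in> {a..b} \<Longrightarrow> \<bar>f' x\<bar> \<le> L"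
    by (auto simp: bounded_pos)
  have "L-lipschitz_on {a..b} f"
  proof (rule bounded_derivative_imp_lipschitz)
    fix x assume x: "x \<in> {a..b}"
    show "(f has_derivative (*) (f' x)) (at x within {a..b})"
      using assms(1) has_field_derivative_def has_derivative_at_withinI by blast
    show "onorm ((*) (f' x)) \<le> L"
      using L(2)[OF x] by (intro onorm_le) (simp add: abs_mult mult_right_mono)
  qed (use L in auto)
  then show ?thesis using that by blast
qed

text \<open>
  A family closed under partial derivatives, because \<open>y \<partial>_y\<close> preserves the functions of
  \<open>max(0,y)^\<alpha>\<close>. For \<open>b = 0\<close> the factor \<open>0 powr 0 = 0\<close> makes the term vanish on \<open>y \<le> 0\<close>, so
  \<open>exp (c * pos_pow \<alpha> y)\<close> itself is not a member and is treated separately.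
\<close>

definition pos_pow_term ::
    "real \<Rightarrow> real \<Rightarrow> real \<Rightarrow> real \<Rightarrow> real \<Rightarrow> real poly \<Rightarrow> real \<times> real \<Rightarrow> real" where
  "pos_pow_term \<alpha> c a0 a1 b P = (\<lambda>p. (a0 + a1 * fst p) *
     (pos_pow b (snd p) * (poly P (pos_pow \<alpha> (snd p)) * exp (c * pos_pow \<alpha> (snd p)))))"

text \<open>On a bounded set \<open>pos_pow \<alpha>\<close> takes values in some
  \<open>{0..M}\<close>, where the smooth outer function \<open>poly P z * exp (c * z)\<close> is
  Lipschitz.\<close>

lemma hoelder_on_poly_exp_pos_pow:
  assumes U: "bounded U" and r: "0 < r" "r \<le> 1" "r \<le> \<alpha>"
  shows "hoelder_on r U (\<lambda>p::real\<times>real. poly P (pos_pow \<alpha> (snd p)) * exp (c * pos_pow \<alpha> (snd p)))"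
proof -
  have snd: "1-lipschitz_on U (snd :: real \<times> real \<Rightarrow> real)"
    by (rule lipschitz_onI) (auto simp: dist_snd_le)
  have h: "hoelder_on r U (\<lambda>p. pos_pow \<alpha> (snd p))"
    using hoelder_on_pos_pow[OF snd U r] .
  obtain M where M: "0 < M" "\<And>p. p \<in> U \<Longrightarrow> pos_pow \<alpha> (snd p) \<le> M"
    using hoelder_on_bounded_image[OF h U r(1)] by (auto simp: bounded_pos)
  obtain L where L: "L-lipschitz_on {0..M} (\<lambda>z. poly P z * exp (c * z))"
  proof (rule C1_imp_lipschitz_on_interval)
    show "((\<lambda>z. poly P z * exp (c * z)) has_real_derivative
        (poly (pderiv P) z + c * poly P z) * exp (c * z)) (at z)" for z
      by (auto intro!: derivative_eq_intros poly_DERIV simp: algebra_simps)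
  qed (intro continuous_intros)
  have "L-lipschitz_on ((\<lambda>p. pos_pow \<alpha> (snd p)) ` U) (\<lambda>z. poly P z * exp (c * z))"
    by (rule lipschitz_on_subset[OF L]) (use M in auto)
  from hoelder_on_lipschitz_compose[OF h this] show ?thesis .
qed

lemma hoelder_on_affine_fst:
  assumes "bounded U" "0 < r" "r \<le> 1"
  shows "hoelder_on r U (\<lambda>p::real\<times>real. a0 + a1 * fst p)"
  using hoelder_on_affine[OF assms, of a0 "(a1, 0)"] by (simp add: inner_prod_def mult.commute)

lemma hoelder_on_pos_pow_term:
  assumes U: "bounded U" and r: "0 < r" "r \<le> 1" "r \<le> \<alpha>" "r \<le> b"
  shows "hoelder_on r U (pos_pow_term \<alpha> c a0 a1 b P)"
proof -
  have snd: "1-lipschitz_on U (snd :: real \<times> real \<Rightarrow> real)"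
    by (rule lipschitz_onI) (auto simp: dist_snd_le)
  show ?thesis
    unfolding pos_pow_term_def
    by (intro hoelder_on_mult hoelder_on_affine_fst hoelder_on_pos_pow[OF snd]
        hoelder_on_poly_exp_pos_pow U r)
qed

text \<open>The x-derivative only replaces the affine factor by its slope. The y-derivative costs
  one power of y; by y F' = \<alpha> F the polynomial becomes b P + \<alpha> z (P' + c P), which is
  \<open>Q\<close>, with \<open>pCons 0\<close> as multiplication by z.\<close>

lemma has_derivative_pos_pow_term:
  fixes P \<alpha> b c
  defines "Q \<equiv> smult b P + smult \<alpha> (pCons 0 (pderiv P + smult c P))"
  assumes "1 < \<alpha>" "1 < b"
  shows "(pos_pow_term \<alpha> c a0 a1 b P has_derivative
    (\<lambda>h. pos_pow_term \<alpha> c a1 0 b P p * fst h + pos_pow_term \<alpha> c a0 a1 (b - 1) Q p * snd h)) (at p)"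
proof -
  define F where "F = pos_pow \<alpha>"
  \<comment> \<open>This is y F' = \<alpha> F in terms of exponents; it lets
    \<open>pos_pow (b - 1)\<close> be factored out of every term of the derivative.\<close>
  have F: "pos_pow (b - 1) y * F y = pos_pow b y * pos_pow (\<alpha> - 1) y" for y
    by (simp add: F_def pos_pow_add algebra_simps)
  have D: "((\<lambda>y. pos_pow b y * (poly P (F y) * exp (c * F y))) has_real_derivative
      pos_pow (b - 1) y * (poly Q (F y) * exp (c * F y))) (at y)" for y
  proof -
    have D0: "((\<lambda>y. pos_pow b y * (poly P (F y) * exp (c * F y))) has_real_derivative
       b * pos_pow (b - 1) y * (poly P (F y) * exp (c * F y)) +
       (poly (pderiv P) (F y) * (\<alpha> * pos_pow (\<alpha> - 1) y) * exp (c * F y) +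
        exp (c * F y) * (c * (\<alpha> * pos_pow (\<alpha> - 1) y)) * poly P (F y)) * pos_pow b y) (at y)"
      unfolding F_def using assms
      by (intro DERIV_mult has_real_derivative_pos_pow DERIV_chain2[OF poly_DERIV]
          DERIV_chain2[OF DERIV_exp] DERIV_cmult)
    have "b * pos_pow (b - 1) y * (poly P (F y) * exp (c * F y)) +
       (poly (pderiv P) (F y) * (\<alpha> * pos_pow (\<alpha> - 1) y) * exp (c * F y) +
        exp (c * F y) * (c * (\<alpha> * pos_pow (\<alpha> - 1) y)) * poly P (F y)) * pos_pow b y =
       (b * pos_pow (b - 1) y * poly P (F y) + \<alpha> * (pos_pow b y * pos_pow (\<alpha> - 1) y) *
        (poly (pderiv P) (F y) + c * poly P (F y))) * exp (c * F y)"
      by (simp add: algebra_simps)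
    also have "\<dots> = pos_pow (b - 1) y * (poly Q (F y) * exp (c * F y))"
      unfolding F[symmetric] Q_def by (simp add: algebra_simps)
    finally show ?thesis using D0 by (simp only:)
  qed
  have "((\<lambda>p. (a0 + a1 * fst p) * (pos_pow b (snd p) * (poly P (F (snd p)) * exp (c * F (snd p)))))
     has_derivative (\<lambda>h. (a0 + a1 * fst p) *
       ((pos_pow (b - 1) (snd p) * (poly Q (F (snd p)) * exp (c * F (snd p)))) * snd h) +
       (a1 * fst h) * (pos_pow b (snd p) * (poly P (F (snd p)) * exp (c * F (snd p)))))) (at p)"
    by (rule has_derivative_mult)
      (auto intro!: derivative_eq_intros has_derivative_compose[OF has_derivative_snd]
        D[unfolded has_field_derivative_def])
  then show ?thesis
    by (simp add: pos_pow_term_def F_def algebra_simps)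
qed

text \<open>This replaces the missing case b = 0: one y-derivative produces the factor
  \<open>pos_pow (\<alpha> - 1)\<close> and lands in the family, while the x-derivative remains a
  pure exponential.\<close>

lemma has_derivative_exp_pos_pow_term:
  assumes "1 < \<alpha>"
  shows "((\<lambda>p. (a0 + a1 * fst p) * exp (c * pos_pow \<alpha> (snd p))) has_derivative
    (\<lambda>h. a1 * exp (c * pos_pow \<alpha> (snd p)) * fst h +
         pos_pow_term \<alpha> c a0 a1 (\<alpha> - 1) [:c * \<alpha>:] p * snd h)) (at p)"
proof -
  have D: "((\<lambda>y. exp (c * pos_pow \<alpha> y)) has_real_derivative
      pos_pow (\<alpha> - 1) y * (c * \<alpha> * exp (c * pos_pow \<alpha> y))) (at y)" for y
    using assms by (auto intro!: derivative_eq_intros)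
  have "((\<lambda>p. (a0 + a1 * fst p) * exp (c * pos_pow \<alpha> (snd p)))
     has_derivative (\<lambda>h. (a0 + a1 * fst p) *
       ((pos_pow (\<alpha> - 1) (snd p) * (c * \<alpha> * exp (c * pos_pow \<alpha> (snd p)))) * snd h) +
       (a1 * fst h) * exp (c * pos_pow \<alpha> (snd p)))) (at p)"
    by (rule has_derivative_mult)
      (auto intro!: derivative_eq_intros has_derivative_compose[OF has_derivative_snd]
        D[unfolded has_field_derivative_def])
  then show ?thesis
    by (simp add: pos_pow_term_def algebra_simps)
qed

lemma zh_class_Suc_pairI:
  fixes f :: "real \<times> real \<Rightarrow> real"
  assumes "hoelder_on r U f" "bounded U" "0 < r"
    and D: "\<And>p. (f has_derivative (\<lambda>h. f1 p * fst h + f2 p * snd h)) (at p)"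
    and "zh_class m r U f1" "zh_class m r U f2"
  shows "zh_class (Suc m) r U f"
proof -
  have "frechet_derivative f (at p) = (\<lambda>h. f1 p * fst h + f2 p * snd h)" for p
    using frechet_derivative_at[OF D] by simp
  moreover have "f differentiable (at p)" for p
    using D differentiableI by blast
  ultimately show ?thesis
    using assms hoelder_on_bounded_image[OF assms(1-3)]
    by (simp add: Basis_prod_def)
qed

text \<open>A y-derivative lowers \<open>b\<close> by one and an x-derivative keeps it, so after
  \<open>n\<close> derivatives the exponent is still at least \<open>r\<close>. The affine factor
  and \<open>P\<close> change on the way and are therefore generalised.\<close>

lemma zh_class_pos_pow_term:
  assumes U: "bounded U" and r: "0 < r" "r \<le> 1" and "1 < \<alpha>"
  shows "real n + r \<le> b \<Longrightarrow> zh_class n r U (pos_pow_term \<alpha> c a0 a1 b P)"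
proof (induction n arbitrary: a0 a1 b P)
  case 0
  then show ?case
    using assms by (intro hoelder_on_imp_zh_class_0 hoelder_on_pos_pow_term) auto
next
  case (Suc n)
  show ?case
  proof (rule zh_class_Suc_pairI[OF hoelder_on_pos_pow_term U r(1) has_derivative_pos_pow_term])
  qed (use Suc assms in \<open>auto intro!: Suc.IH\<close>)
qed

lemma zh_class_exp_pos_pow:
  assumes U: "bounded U" and r: "0 < r" "r \<le> 1" and "1 < \<alpha>"
    and n: "real n + r \<le> \<alpha>"
  shows "zh_class n r U (\<lambda>p. (a0 + a1 * fst p) * exp (c * pos_pow \<alpha> (snd p)))"
proof -
  have h: "hoelder_on r U (\<lambda>p. (a0 + a1 * fst p) * exp (c * pos_pow \<alpha> (snd p)))" for a0 a1
    using hoelder_on_mult[OF hoelder_on_affine_fst[OF U r] hoelder_on_poly_exp_pos_pow[OF U r, of \<alpha> 1] U r(1)]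
      assms by simp
  show ?thesis
    using n
  proof (induction n arbitrary: a0 a1)
    case 0
    show ?case
      using hoelder_on_imp_zh_class_0[OF h U r] .
  next
    case (Suc n)
    \<comment> \<open>The x-derivative is an exponential with constant factor, covered by the
      induction hypothesis; the y-derivative has exponent \<open>\<alpha> - 1\<close>, which leaves
      room for \<open>n\<close> further derivatives.\<close>
    have "zh_class n r U (\<lambda>p. a1 * exp (c * pos_pow \<alpha> (snd p)))"
      using Suc.IH[of a1 0] Suc.prems by simp
    then show ?case
      using Suc.prems assms
      by (intro zh_class_Suc_pairI[OF h U r(1) has_derivative_exp_pos_pow_term] zh_class_pos_pow_term) auto
  qed
qed

lemma zygmund_holder_loc_exp_pos_pow:
  assumes "1 < \<alpha>"
  shows "zygmund_holder_loc \<alpha> UNIV (\<lambda>p. (a0 + a1 * fst p) * exp (c * pos_pow \<alpha> (snd p)))"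
proof -
  obtain m r where mr: "\<alpha> = real m + r" "0 < r" "r \<le> 1"
    using zh_order_decomposition[of \<alpha>] assms by auto
  show ?thesis
    by (rule zygmund_holder_locI[OF mr], rule zh_class_exp_pos_pow[OF _ mr(2,3) assms])
      (use mr(1) in simp_all)
qed

subsection \<open>The straightening chart\<close>

definition straightening :: "real \<Rightarrow> real \<times> real \<Rightarrow> real \<times> real" where
  "straightening \<alpha> = (\<lambda>(x, y). (x * exp (- pos_pow \<alpha> y), y))"

definition straightening_inv :: "real \<Rightarrow> real \<times> real \<Rightarrow> real \<times> real" where
  "straightening_inv \<alpha> = (\<lambda>(u, v). (u * exp (pos_pow \<alpha> v), v))"

lemma straightening_inverse [simp]:
  "straightening_inv \<alpha> (straightening \<alpha> p) = p" "straightening \<alpha> (straightening_inv \<alpha> q) = q"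
  by (auto simp: straightening_def straightening_inv_def split: prod.splits simp flip: exp_add)

lemma bij_straightening: "bij (straightening \<alpha>)"
  by (rule bij_betw_byWitness[of _ "straightening_inv \<alpha>"]) auto

lemma bij_straightening_inv: "bij (straightening_inv \<alpha>)"
  by (rule bij_betw_byWitness[of _ "straightening \<alpha>"]) auto

lemma inv_into_straightening: "inv_into UNIV (straightening \<alpha>) = straightening_inv \<alpha>"
  by (rule inv_equality) auto

lemma zh_loc_map_straightening:
  assumes "1 < \<alpha>"
  shows "zh_loc_map \<alpha> UNIV (straightening \<alpha>)" "zh_loc_map \<alpha> UNIV (straightening_inv \<alpha>)"
proof -
  have snd: "zygmund_holder_loc \<alpha> UNIV (snd :: real \<times> real \<Rightarrow> real)"
    using zygmund_holder_loc_affine[of \<alpha> 0 "(0, 1) :: real \<times> real"] assms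
    by (simp add: inner_prod_def inner_real_def)
  have fst: "zygmund_holder_loc \<alpha> UNIV (\<lambda>p::real\<times>real. fst p * exp (c * pos_pow \<alpha> (snd p)))" for c
    using zygmund_holder_loc_exp_pos_pow[OF assms, of 0 1 c] by simp
  show "zh_loc_map \<alpha> UNIV (straightening \<alpha>)"
    using snd fst[of "-1"]
    by (simp add: zh_loc_map_def Basis_prod_def straightening_def case_prod_unfold)
  show "zh_loc_map \<alpha> UNIV (straightening_inv \<alpha>)"
    using snd fst[of 1]
    by (simp add: zh_loc_map_def Basis_prod_def straightening_inv_def case_prod_unfold)
qed

lemma zh_loc_map_id:
  assumes "0 < s"
  shows "zh_loc_map s UNIV (\<lambda>p. p :: 'a::euclidean_space)"
proof -
  have "zygmund_holder_loc s UNIV (\<lambda>p::'a. p \<bullet> b)" for b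
    using zygmund_holder_loc_affine[OF assms, of 0 b] by simp
  then show ?thesis by (simp add: zh_loc_map_def)
qed

text \<open>With a single chart the only transition map is the identity, which is of every class. So
  the atlas may have order \<open>\<alpha> + 1\<close> although its chart is only asked to be of
  order \<alpha> in standard coordinates.\<close>

lemma zh_atlas_straightening:
  assumes "1 < \<alpha>"
  shows "zh_atlas (\<alpha> + 1) {(UNIV, straightening \<alpha>)}"
proof -
  have "continuous_on UNIV (straightening \<alpha>)" "continuous_on UNIV (straightening_inv \<alpha>)"
    using assms unfolding straightening_def straightening_inv_def case_prod_unfold
    by (auto intro!: continuous_intros)
  then have "homeomorphism UNIV UNIV (straightening \<alpha>) (straightening_inv \<alpha>)"
    using bij_straightening[of \<alpha>] bij_straightening_inv[of \<alpha>]
    by (simp add: homeomorphism_def bij_def)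
  moreover have "straightening \<alpha> \<circ> straightening_inv \<alpha> = (\<lambda>p. p)"
    by auto
  ultimately show ?thesis
    using bij_straightening[of \<alpha>] zh_loc_map_id[of "\<alpha> + 1"] assms
    by (simp add: zh_atlas_def is_chart_def inv_into_straightening bij_def)
qed

lemma has_derivative_straightening:
  assumes "1 < \<alpha>"
  shows "(straightening \<alpha> has_derivative
    (\<lambda>h. (exp (- pos_pow \<alpha> (snd p)) * fst h -
          fst p * (\<alpha> * pos_pow (\<alpha> - 1) (snd p)) * exp (- pos_pow \<alpha> (snd p)) * snd h, snd h))) (at p)"
proof -
  have "((\<lambda>p. fst p * exp (- pos_pow \<alpha> (snd p))) has_derivative
    (\<lambda>h. exp (- pos_pow \<alpha> (snd p)) * fst h -
          fst p * (\<alpha> * pos_pow (\<alpha> - 1) (snd p)) * exp (- pos_pow \<alpha> (snd p)) * snd h)) (at p)"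
    using has_derivative_exp_pos_pow_term[OF assms, of 0 1 "-1" p]
    by (simp add: pos_pow_term_def algebra_simps)
  then show ?thesis
    unfolding straightening_def case_prod_unfold
    by (intro has_derivative_Pair has_derivative_snd has_derivative_ident)
qed

lemma zh_field_wrt_straightening:
  assumes "1 < \<alpha>"
  shows "zh_field_wrt \<alpha> {(UNIV, straightening \<alpha>)} (\<lambda>(x, y). (1, 0))"
    and "zh_field_wrt \<alpha> {(UNIV, straightening \<alpha>)}
           (\<lambda>(x, y). (x * (\<alpha> * max 0 y powr (\<alpha> - 1)), 1))"
proof -
  note D = frechet_derivative_at[OF has_derivative_straightening[OF assms], symmetric]
  have const: "zygmund_holder_loc \<alpha> UNIV (\<lambda>p::real\<times>real. c)" for c
    using zygmund_holder_loc_affine[of \<alpha> c 0] assms by simp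
  have X: "in_chart (UNIV, straightening \<alpha>) (\<lambda>(x, y). (1, 0)) = (\<lambda>q. (exp (- pos_pow \<alpha> (snd q)), 0))"
    by (simp add: in_chart_def inv_into_straightening D straightening_inv_def case_prod_unfold)
  \<comment> \<open>The shear term in the derivative of the chart exactly cancels the contribution
    of x f(y), so the field becomes constant.\<close>
  have Y: "in_chart (UNIV, straightening \<alpha>) (\<lambda>(x, y). (x * (\<alpha> * max 0 y powr (\<alpha> - 1)), 1))
      = (\<lambda>q. (0, 1))"
    by (simp add: in_chart_def inv_into_straightening D straightening_inv_def case_prod_unfold
        flip: pos_pow_def)
  have *: "straightening \<alpha> ` UNIV = UNIV"
    using bij_straightening[of \<alpha>] by (simp add: bij_def)
  show "zh_field_wrt \<alpha> {(UNIV, straightening \<alpha>)} (\<lambda>(x, y). (1, 0))"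
    using const zygmund_holder_loc_exp_pos_pow[OF assms, of 1 0 "-1"]
    by (auto simp: zh_field_wrt_def X * zh_loc_map_def Basis_prod_def)
  show "zh_field_wrt \<alpha> {(UNIV, straightening \<alpha>)}
           (\<lambda>(x, y). (x * (\<alpha> * max 0 y powr (\<alpha> - 1)), 1))"
    using const by (auto simp: zh_field_wrt_def Y * zh_loc_map_def Basis_prod_def)
qed

lemma compatible_with_standard_straightening:
  assumes "1 < \<alpha>"
  shows "compatible_with_standard \<alpha> {(UNIV, straightening \<alpha>)}"
  using zh_loc_map_straightening[OF assms] bij_straightening[of \<alpha>]
  by (simp add: compatible_with_standard_def inv_into_straightening bij_def)

subsection \<open>The canonical coordinates\<close>

text \<open>This is h of the overview, the mean of e^{-F} over the segment from 0 to s. Rescaling to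
  [0,1] treats all signs of s alike and avoids a division by s at 0.\<close>

definition damping :: "real \<Rightarrow> real \<Rightarrow> real" where
  "damping \<alpha> s = integral {0..1} (\<lambda>u. exp (- pos_pow \<alpha> (s * u)))"

definition damping' :: "real \<Rightarrow> real \<Rightarrow> real" where
  "damping' \<alpha> s = - integral {0..1} (\<lambda>u. \<alpha> * u * pos_pow (\<alpha> - 1) (s * u) * exp (- pos_pow \<alpha> (s * u)))"

text \<open>Differentiation under the integral sign: because \<alpha> > 1, the s-derivative of the
  integrand exists and is jointly continuous.\<close>

lemma damping_has_real_derivative:
  assumes "1 < \<alpha>"
  shows "(damping \<alpha> has_real_derivative damping' \<alpha> s) (at s)"
proof -
  have "((\<lambda>s. integral (cbox 0 1) (\<lambda>u. exp (- pos_pow \<alpha> (s * u)))) has_real_derivative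
     integral (cbox 0 1) (\<lambda>u. - (\<alpha> * u * pos_pow (\<alpha> - 1) (s * u) * exp (- pos_pow \<alpha> (s * u)))))
     (at s within UNIV)"
  proof (rule leibniz_rule_field_derivative)
    show "((\<lambda>s. exp (- pos_pow \<alpha> (s * u))) has_real_derivative
        - (\<alpha> * u * pos_pow (\<alpha> - 1) (s * u) * exp (- pos_pow \<alpha> (s * u)))) (at s within UNIV)" for s u
      using assms by (auto intro!: derivative_eq_intros)
    show "(\<lambda>u. exp (- pos_pow \<alpha> (s * u))) integrable_on cbox 0 1" for s
      using assms by (intro integrable_continuous continuous_intros) auto
    show "continuous_on (UNIV \<times> cbox 0 1)
        (\<lambda>(s, u). - (\<alpha> * u * pos_pow (\<alpha> - 1) (s * u) * exp (- pos_pow \<alpha> (s * u))))"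
      using assms unfolding case_prod_unfold by (intro continuous_intros) auto
  qed auto
  then show ?thesis
    by (simp add: damping_def[abs_def] damping'_def)
qed

lemma continuous_on_damping':
  assumes "1 < \<alpha>"
  shows "continuous_on S (damping' \<alpha>)"
proof -
  have "continuous_on S (\<lambda>s. integral (cbox 0 1)
      (\<lambda>u. \<alpha> * u * pos_pow (\<alpha> - 1) (s * u) * exp (- pos_pow \<alpha> (s * u))))"
    using assms by (intro integral_continuous_on_param)
      (auto simp: case_prod_unfold intro!: continuous_intros)
  then show ?thesis
    by (auto simp: damping'_def[abs_def] intro: continuous_on_minus)
qed

text \<open>Positivity makes the derivative of \<Phi> invertible; the bound 1 allows the denominator
  of the pulled back field to be dropped in lower estimates.\<close>

lemma damping_bounds:
  assumes "1 < \<alpha>"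
  shows "0 < damping \<alpha> s" "damping \<alpha> s \<le> 1"
proof -
  have i: "(\<lambda>u. exp (- pos_pow \<alpha> (s * u))) integrable_on {0..1}"
    using assms by (intro integrable_continuous_real continuous_intros) auto
  have "integral {0..1} (\<lambda>u. exp (- pos_pow \<alpha> (s * u))) \<le> integral {0..1::real} (\<lambda>u. 1)"
    using i by (intro integral_le) auto
  then show "damping \<alpha> s \<le> 1"
    by (simp add: damping_def)
  \<comment> \<open>F is nondecreasing, so F(s u) never exceeds F(|s|) and the integrand has a
    positive lower bound independent of u.\<close>
  have "exp (- pos_pow \<alpha> \<bar>s\<bar>) \<le> exp (- pos_pow \<alpha> (s * u))" if "u \<in> {0..1}" for u
  proof -
    have "s * u \<le> \<bar>s\<bar> * u"
      using that by (intro mult_right_mono) auto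
    also have "\<dots> \<le> \<bar>s\<bar>"
      using that by (intro mult_left_le) auto
    finally have "pos_pow \<alpha> (s * u) \<le> pos_pow \<alpha> \<bar>s\<bar>"
      using assms unfolding pos_pow_def by (intro powr_mono2) auto
    then show ?thesis by simp
  qed
  then have "integral {0..1::real} (\<lambda>u. exp (- pos_pow \<alpha> \<bar>s\<bar>)) \<le> damping \<alpha> s"
    unfolding damping_def using i by (intro integral_le) auto
  then have "exp (- pos_pow \<alpha> \<bar>s\<bar>) \<le> damping \<alpha> s" by simp
  then show "0 < damping \<alpha> s"
    using exp_gt_zero less_le_trans by blast
qed

lemma damping'_nonpos:
  assumes "s \<le> 0"
  shows "damping' \<alpha> s = 0"
proof -
  have "integral {0..1} (\<lambda>u. \<alpha> * u * pos_pow (\<alpha> - 1) (s * u) * exp (- pos_pow \<alpha> (s * u))) =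
      integral {0..1::real} (\<lambda>u. 0)"
    using assms by (intro integral_cong) (auto simp: mult_nonpos_nonneg)
  then show ?thesis by (simp add: damping'_def)
qed

text \<open>Since s u \<le> 1, the exponential is at least e^{-1}; what remains is u (s
  u)^{\<alpha>-1} = s^{\<alpha>-1} u^\<alpha>, whose integral supplies the factor
  1/(\<alpha>+1).\<close>

lemma damping'_le:
  assumes "1 < \<alpha>" "0 \<le> s" "s \<le> 1"
  shows "damping' \<alpha> s \<le> - (\<alpha> * exp (- 1) / (\<alpha> + 1)) * s powr (\<alpha> - 1)"
proof -
  define K where "K = \<alpha> * exp (- 1) * s powr (\<alpha> - 1)"
  have "((\<lambda>u. u powr \<alpha>) has_integral 1 / (\<alpha> + 1)) {0..1}"
    using has_integral_powr_from_0[of \<alpha> 1] assms by simp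
  then have I: "((\<lambda>u. K * u powr \<alpha>) has_integral K * (1 / (\<alpha> + 1))) {0..1}"
    by (rule has_integral_mult_right)
  have "K * u powr \<alpha> \<le> \<alpha> * u * pos_pow (\<alpha> - 1) (s * u) * exp (- pos_pow \<alpha> (s * u))"
    if u: "u \<in> {0..1}" for u
  proof -
    have su: "0 \<le> s * u" "s * u \<le> 1"
      using u assms by (auto intro: mult_le_one)
    then have "pos_pow \<alpha> (s * u) \<le> 1"
      using powr_mono2[of \<alpha> "s * u" 1] assms by (simp add: pos_pow_def)
    then have e: "exp (- 1) \<le> exp (- pos_pow \<alpha> (s * u))" by simp
    have "u * u powr (\<alpha> - 1) = u powr \<alpha>"
      using u by (cases "u = 0") (auto simp: powr_diff)
    then have "K * u powr \<alpha> = \<alpha> * u * pos_pow (\<alpha> - 1) (s * u) * exp (- 1)"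
      using su u assms by (simp add: K_def pos_pow_def powr_mult)
    also have "\<dots> \<le> \<alpha> * u * pos_pow (\<alpha> - 1) (s * u) * exp (- pos_pow \<alpha> (s * u))"
      using e u assms by (intro mult_left_mono) auto
    finally show ?thesis .
  qed
  then have "integral {0..1} (\<lambda>u. K * u powr \<alpha>) \<le> - damping' \<alpha> s"
    unfolding damping'_def minus_minus using assms
    by (intro integral_le has_integral_integrable[OF I] integrable_continuous_real continuous_intros) auto
  then show ?thesis
    using integral_unique[OF I] by (simp add: K_def)
qed

definition flow_endpoint :: "real \<Rightarrow> real \<times> real \<Rightarrow> real \<times> real" where
  "flow_endpoint \<alpha> = (\<lambda>(t, s). (t * exp (pos_pow \<alpha> s) * damping \<alpha> s, s))"

text \<open>For \<alpha> < 2 the field need not be locally Lipschitz, so uniqueness is proved by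
  hand: y is forced to be linear in time, after which x solves a scalar linear equation. The
  equivalence gives existence and uniqueness at once, which the \<open>THE\<close> in
  \<open>exp_field\<close> requires.\<close>

lemma flows_to_iff:
  assumes "1 < \<alpha>"
  shows "flows_to (\<lambda>(x, y). (t + s * (x * (\<alpha> * pos_pow (\<alpha> - 1) y)), s)) (0, 0) q \<longleftrightarrow>
    q = flow_endpoint \<alpha> (t, s)"
proof
  let ?V = "\<lambda>(x, y). (t + s * (x * (\<alpha> * pos_pow (\<alpha> - 1) y)), s)"
  assume "flows_to ?V (0, 0) q"
  then obtain E where E: "\<And>r. r \<in> {0..1} \<Longrightarrow> (E has_vector_derivative ?V (E r)) (at r within {0..1})"
    "E 0 = (0, 0)" "E 1 = q"
    unfolding flows_to_def by blast
  define x where "x r = fst (E r)" for r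
  define y where "y r = snd (E r)" for r
  have y': "(y has_real_derivative s) (at r within {0..1})" if "r \<in> {0..1}" for r
    using bounded_linear.has_vector_derivative[OF bounded_linear_snd E(1)[OF that]]
    by (simp add: has_real_derivative_iff_has_vector_derivative y_def[abs_def] case_prod_unfold)
  have x': "(x has_real_derivative t + s * (x r * (\<alpha> * pos_pow (\<alpha> - 1) (y r)))) (at r within {0..1})"
    if "r \<in> {0..1}" for r
    using bounded_linear.has_vector_derivative[OF bounded_linear_fst E(1)[OF that]]
    by (simp add: has_real_derivative_iff_has_vector_derivative x_def[abs_def] y_def case_prod_unfold)
  have "\<exists>c. \<forall>r\<in>{0..1}. y r - s * r = c"
    by (rule has_field_derivative_zero_constant) (auto intro!: derivative_eq_intros y')
  then obtain c where c: "\<And>r. r \<in> {0..1} \<Longrightarrow> y r - s * r = c"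
    by blast
  have y: "y r = s * r" if "r \<in> {0..1}" for r
    using c[OF that] c[of 0] E(2) by (simp add: y_def)
  \<comment> \<open>The integrating factor removes the term containing \<open>x r\<close>, so the
    product is a primitive of a known function.\<close>
  have "((\<lambda>r. x r * exp (- pos_pow \<alpha> (s * r))) has_real_derivative t * exp (- pos_pow \<alpha> (s * r)))
      (at r within {0..1})" if "r \<in> {0..1}" for r
    by (rule derivative_eq_intros x'[OF that] refl assms)+ (simp add: y[OF that] algebra_simps)
  then have "((\<lambda>r. t * exp (- pos_pow \<alpha> (s * r))) has_integral
      x 1 * exp (- pos_pow \<alpha> (s * 1)) - x 0 * exp (- pos_pow \<alpha> (s * 0))) {0..1}"
    by (intro fundamental_theorem_of_calculus)
      (auto simp: has_real_derivative_iff_has_vector_derivative)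
  then have "x 1 * exp (- pos_pow \<alpha> s) = t * damping \<alpha> s"
    using E(2) by (simp add: damping_def x_def has_integral_integrable_integral)
  then have "x 1 = t * exp (pos_pow \<alpha> s) * damping \<alpha> s"
    by (simp add: exp_minus field_simps)
  then show "q = flow_endpoint \<alpha> (t, s)"
    using y[of 1] E(3) by (simp add: x_def y_def flow_endpoint_def prod_eq_iff)
next
  let ?V = "\<lambda>(x, y). (t + s * (x * (\<alpha> * pos_pow (\<alpha> - 1) y)), s)"
  \<comment> \<open>Variation of constants: \<open>J\<close> is the primitive of the integrating
    factor, with value 0 at 0 and \<open>damping \<alpha> s\<close> at 1.\<close>
  define J where "J r = integral {0..r} (\<lambda>u. exp (- pos_pow \<alpha> (s * u)))" for r
  define E where "E r = (t * exp (pos_pow \<alpha> (s * r)) * J r, s * r)" for r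
  have J: "(J has_real_derivative exp (- pos_pow \<alpha> (s * r))) (at r within {0..1})"
    if "r \<in> {0..1}" for r
    unfolding J_def[abs_def] using that assms
    by (intro integral_has_real_derivative continuous_intros) auto
  have x: "((\<lambda>r. t * exp (pos_pow \<alpha> (s * r)) * J r) has_real_derivative
      t + s * (t * exp (pos_pow \<alpha> (s * r)) * J r * (\<alpha> * pos_pow (\<alpha> - 1) (s * r)))) (at r within {0..1})"
    if "r \<in> {0..1}" for r
    by (rule derivative_eq_intros J[OF that] refl assms)+ (simp add: algebra_simps flip: exp_add)
  have "(E has_vector_derivative ?V (E r)) (at r within {0..1})" if "r \<in> {0..1}" for r
  proof -
    have "((\<lambda>r. s * r) has_real_derivative s) (at r within {0..1})"
      by (auto intro!: derivative_eq_intros)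
    then show ?thesis
      using x[OF that] unfolding E_def[abs_def] has_real_derivative_iff_has_vector_derivative
      by (auto intro: has_vector_derivative_Pair)
  qed
  moreover assume "q = flow_endpoint \<alpha> (t, s)"
  ultimately show "flows_to ?V (0, 0) q"
    by (auto simp: flows_to_def E_def J_def flow_endpoint_def damping_def intro!: exI[of _ E])
qed

section \<open>Derivative of the canonical coordinates and the pulled back field\<close>

definition flow_deriv :: "real \<Rightarrow> real \<times> real \<Rightarrow> real \<times> real \<Rightarrow> real \<times> real" where
  "flow_deriv \<alpha> p = (\<lambda>h. (exp (pos_pow \<alpha> (snd p)) * (damping \<alpha> (snd p) * fst h +
     fst p * (\<alpha> * pos_pow (\<alpha> - 1) (snd p) * damping \<alpha> (snd p) + damping' \<alpha> (snd p)) * snd h), snd h))"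

lemma has_derivative_flow_endpoint:
  assumes "1 < \<alpha>"
  shows "(flow_endpoint \<alpha> has_derivative flow_deriv \<alpha> p) (at p)"
proof -
  have D: "((\<lambda>s. exp (pos_pow \<alpha> s) * damping \<alpha> s) has_real_derivative
      exp (pos_pow \<alpha> s) * (\<alpha> * pos_pow (\<alpha> - 1) s * damping \<alpha> s + damping' \<alpha> s)) (at s)" for s
    using assms by (auto intro!: derivative_eq_intros damping_has_real_derivative simp: algebra_simps)
  have "((\<lambda>p. fst p * (exp (pos_pow \<alpha> (snd p)) * damping \<alpha> (snd p))) has_derivative
    (\<lambda>h. fst p * ((exp (pos_pow \<alpha> (snd p)) * (\<alpha> * pos_pow (\<alpha> - 1) (snd p) * damping \<alpha> (snd p) + damping' \<alpha> (snd p))) * snd h)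
      + fst h * (exp (pos_pow \<alpha> (snd p)) * damping \<alpha> (snd p)))) (at p)"
    by (rule has_derivative_mult)
      (auto intro!: derivative_eq_intros has_derivative_compose[OF has_derivative_snd]
        D[unfolded has_field_derivative_def])
  then have "((\<lambda>p. (fst p * (exp (pos_pow \<alpha> (snd p)) * damping \<alpha> (snd p)), snd p)) has_derivative
      flow_deriv \<alpha> p) (at p)"
    unfolding flow_deriv_def
    by (intro has_derivative_Pair has_derivative_snd has_derivative_ident) (simp add: algebra_simps)
  then show ?thesis
    by (simp add: flow_endpoint_def case_prod_unfold mult.assoc)
qed

lemma frechet_derivative_flow_endpoint:
  assumes "1 < \<alpha>"
  shows "frechet_derivative (flow_endpoint \<alpha>) (at p) = flow_deriv \<alpha> p"
  using frechet_derivative_at[OF has_derivative_flow_endpoint[OF assms]] by simp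

text \<open>The matrix is triangular with diagonal entries e^F h and 1, both nonzero; the inverse is
  written down by back substitution.\<close>

lemma bij_flow_deriv:
  assumes "1 < \<alpha>"
  shows "bij (flow_deriv \<alpha> p)"
proof -
  have "damping \<alpha> (snd p) \<noteq> 0"
    using damping_bounds(1)[OF assms, of "snd p"] by simp
  then show ?thesis
    by (intro bij_betw_byWitness[of _ "\<lambda>k. ((fst k * exp (- pos_pow \<alpha> (snd p)) -
      fst p * (\<alpha> * pos_pow (\<alpha> - 1) (snd p) * damping \<alpha> (snd p) + damping' \<alpha> (snd p)) * snd k) /
        damping \<alpha> (snd p), snd k)"])
      (auto simp: flow_deriv_def exp_minus field_simps)
qed

lemma C1_diffeo_on_flow_endpoint:
  assumes "1 < \<alpha>"
  shows "C1_diffeo_on UNIV (flow_endpoint \<alpha>)"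
proof -
  have "damping \<alpha> s \<noteq> 0" for s
    using damping_bounds(1)[OF assms, of s] by simp
  then have inj: "inj (flow_endpoint \<alpha>)"
    by (auto simp: inj_on_def flow_endpoint_def)
  have diff: "flow_endpoint \<alpha> differentiable (at p)" for p
    using has_derivative_flow_endpoint[OF assms] differentiableI by blast
  have "continuous_on UNIV (damping \<alpha>)"
    using damping_has_real_derivative[OF assms] DERIV_isCont
    by (simp add: continuous_on_eq_continuous_at) blast
  then have "continuous_on UNIV (\<lambda>p::real\<times>real. damping \<alpha> (snd p))"
    by (rule continuous_on_compose2) (auto intro: continuous_intros)
  moreover have "continuous_on UNIV (\<lambda>p::real\<times>real. damping' \<alpha> (snd p))"
    by (rule continuous_on_compose2[OF continuous_on_damping'[OF assms, of UNIV]])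
      (auto intro: continuous_intros)
  ultimately have "continuous_on UNIV (\<lambda>p. flow_deriv \<alpha> p h)" for h
    using assms unfolding flow_deriv_def by (intro continuous_intros) auto
  with inj diff show ?thesis
    using assms unfolding C1_diffeo_on_def frechet_derivative_flow_endpoint[OF assms]
    by (simp add: bij_flow_deriv)
qed

text \<open>No inverse is computed: the candidate vector is mapped forward. The two contributions of
  \<open>damping'\<close> cancel and only the one with F' survives, which is the first component of
  the field at \<Phi>(t,s).\<close>

lemma pullback_flow_endpoint:
  assumes "1 < \<alpha>"
  shows "pullback_field (flow_endpoint \<alpha>) (\<lambda>(x, y). (x * (\<alpha> * pos_pow (\<alpha> - 1) y), 1)) (t, s) =
    (- t * damping' \<alpha> s / damping \<alpha> s, 1)"
proof -
  have "damping \<alpha> s \<noteq> 0"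
    using damping_bounds(1)[OF assms, of s] by simp
  then have "flow_deriv \<alpha> (t, s) (- t * damping' \<alpha> s / damping \<alpha> s, 1) =
      (\<lambda>(x, y). (x * (\<alpha> * pos_pow (\<alpha> - 1) y), 1)) (flow_endpoint \<alpha> (t, s))"
    by (simp add: flow_deriv_def flow_endpoint_def field_simps)
  then show ?thesis
    unfolding pullback_field_def frechet_derivative_flow_endpoint[OF assms]
    using bij_flow_deriv[OF assms] by (intro inv_f_eq) (auto simp: bij_def)
qed

subsection \<open>Functions vanishing on a half plane\<close>

text \<open>
  For \<open>r = 1\<close>, \<open>m = 0\<close> the Zygmund condition still gives a linear bound: the second difference at a
  boundary point reduces to the value on the one side where the function does not vanish.
\<close>

lemma zh_class_vanishing_imp_growth:
  fixes u :: "real \<times> real \<Rightarrow> real"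
  assumes "zh_class m r (ball c e) u" "0 < r" "r \<le> 1"
    and "\<And>x y. (x, y) \<in> ball c e \<Longrightarrow> y \<le> 0 \<Longrightarrow> u (x, y) = 0"
    and "0 < d" "\<And>s. \<bar>s\<bar> \<le> d \<Longrightarrow> (t, s) \<in> ball c e"
  shows "\<exists>C\<ge>0. \<forall>s. 0 < s \<and> s \<le> d \<longrightarrow> \<bar>u (t, s)\<bar> \<le> C * s powr (real m + r)"
  using assms(1,4)
proof (induction m arbitrary: u)
  case 0
  have ball: "(t, s) \<in> ball c e" "(t, - s) \<in> ball c e" "(t, 0) \<in> ball c e" if "0 < s" "s \<le> d" for s
    using assms(6)[of s] assms(6)[of "- s"] assms(6)[of 0] that by auto
  have zero: "u (t, 0) = 0" "u (t, - s) = 0" if "0 < s" "s \<le> d" for s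
    using 0(2) ball[OF that] that by auto
  have norm: "norm ((0::real), s) = s" if "0 < s" for s :: real
    using that by (simp add: norm_Pair)
  obtain C where C: "\<And>s. 0 < s \<Longrightarrow> s \<le> d \<Longrightarrow> \<bar>u (t, s)\<bar> \<le> C * s powr r"
  proof (cases "r < 1")
    case True
    then obtain C where C: "\<And>x y. x \<in> ball c e \<Longrightarrow> y \<in> ball c e \<Longrightarrow> \<bar>u x - u y\<bar> \<le> C * norm (x - y) powr r"
      using 0(1) by (auto simp del: mem_ball)
    have "\<bar>u (t, s)\<bar> \<le> C * s powr r" if "0 < s" "s \<le> d" for s
      using C[OF ball(1,3), OF that that] zero[OF that] norm[OF that(1)] by simp
    then show ?thesis using that by blast
  next
    case False
    then have "\<exists>C. \<forall>x h. x \<in> ball c e \<and> x + h \<in> ball c e \<and> x - h \<in> ball c e \<longrightarrow>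
        \<bar>u (x + h) + u (x - h) - 2 * u x\<bar> \<le> C * norm h"
      using 0(1) by (simp del: mem_ball)
    then obtain C where C: "\<And>x h. x \<in> ball c e \<Longrightarrow> x + h \<in> ball c e \<Longrightarrow> x - h \<in> ball c e \<Longrightarrow>
        \<bar>u (x + h) + u (x - h) - 2 * u x\<bar> \<le> C * norm h"
      by blast
    have "\<bar>u (t, s)\<bar> \<le> C * s powr r" if "0 < s" "s \<le> d" for s
      using C[of "(t, 0)" "(0, s)"] ball[OF that] zero[OF that] norm[OF that(1)] False assms(3) that
      by (simp del: mem_ball)
    then show ?thesis using that by blast
  qed
  \<comment> \<open>The definition of the class does not fix the sign of its constant.\<close>
  have "\<bar>u (t, s)\<bar> \<le> \<bar>C\<bar> * s powr r" if "0 < s" "s \<le> d" for s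
    using C[OF that] by (rule order_trans) (simp add: mult_right_mono)
  then show ?case by (intro exI[of _ "\<bar>C\<bar>"]) simp
next
  case (Suc m)
  \<comment> \<open>The induction descends through the y-derivative, which has one order less and,
    as shown below, vanishes on the same part of the ball.\<close>
  define w where "w p = frechet_derivative u (at p) (0, 1)" for p
  have w: "zh_class m r (ball c e) w"
    using Suc.prems(1) by (simp add: Basis_prod_def w_def[abs_def])
  have D: "((\<lambda>s. u (x, s)) has_real_derivative w (x, y)) (at y)" if "(x, y) \<in> ball c e" for x y
  proof -
    have "(u has_derivative frechet_derivative u (at (x, y))) (at (x, y))"
      using Suc.prems(1) that by (simp add: frechet_derivative_works)
    moreover have "((\<lambda>s. (x, s)) has_derivative (\<lambda>h. (0, h))) (at y)"
      by (auto intro!: derivative_eq_intros)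
    ultimately have "((\<lambda>s. u (x, s)) has_derivative (\<lambda>h. frechet_derivative u (at (x, y)) (0, h))) (at y)"
      using has_derivative_compose[of "\<lambda>s. (x, s)"] by blast
    moreover have "frechet_derivative u (at (x, y)) (0, h) = w (x, y) * h" for h
    proof -
      have "linear (frechet_derivative u (at (x, y)))"
        using Suc.prems(1) that by (simp add: linear_frechet_derivative)
      from linear_scale[OF this, of h "(0, 1)"] show ?thesis
        by (simp add: w_def mult.commute)
    qed
    ultimately show ?thesis
      by (simp add: has_field_derivative_def)
  qed
  have "w (x, y) = 0" if xy: "(x, y) \<in> ball c e" and "y \<le> 0" for x y
  proof -
    have "open ((\<lambda>s. (x, s)) -` ball c e)"
      by (intro continuous_open_vimage continuous_intros) auto
    then obtain \<delta> where \<delta>: "0 < \<delta>" "\<And>s. dist s y < \<delta> \<Longrightarrow> (x, s) \<in> ball c e"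
      using xy by (auto simp: open_dist simp del: mem_ball)
    \<comment> \<open>At y = 0 the function is known to vanish only on one side, so the derivative
      is identified as a left derivative.\<close>
    have "((\<lambda>s. 0) has_real_derivative w (x, y)) (at y within {..y})"
    proof (rule has_field_derivative_transform_within[OF has_field_derivative_at_within[OF D[OF xy]] \<delta>(1)])
      fix s assume "s \<in> {..y}" "dist s y < \<delta>"
      then show "u (x, s) = 0"
        using Suc.prems(2) \<delta>(2) \<open>y \<le> 0\<close> by auto
    qed simp
    moreover have "((\<lambda>s. 0) has_real_derivative 0) (at y within {..y})"
      by simp
    moreover have "at y within {..y} \<noteq> bot"
      by (simp add: at_within_Iic_at_left)
    ultimately show ?thesis
      using has_field_derivative_unique by blast
  qed
  from Suc.IH[OF w this] obtain C where C: "0 \<le> C"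
    "\<And>s. 0 < s \<Longrightarrow> s \<le> d \<Longrightarrow> \<bar>w (t, s)\<bar> \<le> C * s powr (real m + r)"
    by auto
  have "\<bar>u (t, s)\<bar> \<le> C * s powr (real (Suc m) + r)" if s: "0 < s" "s \<le> d" for s
  proof -
    \<comment> \<open>Starting from the value 0 on the boundary, the mean value theorem turns the
      bound for \<open>w\<close> into one for \<open>u\<close> with one more power of s.\<close>
    have "\<exists>z>0. z < s \<and> u (t, s) - u (t, 0) = (s - 0) * w (t, z)"
      using s by (intro MVT2 D assms(6)) auto
    then obtain z where z: "0 < z" "z < s" "u (t, s) - u (t, 0) = s * w (t, z)"
      by auto
    have "u (t, 0) = 0"
      using Suc.prems(2) assms(5,6) by auto
    then have "\<bar>u (t, s)\<bar> = s * \<bar>w (t, z)\<bar>"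
      using z s by (simp add: abs_mult)
    also have "\<dots> \<le> s * (C * z powr (real m + r))"
      using C(2)[of z] z s by (intro mult_left_mono) auto
    also have "\<dots> \<le> s * (C * s powr (real m + r))"
      using C(1) z s assms(2) by (intro mult_left_mono powr_mono2) auto
    also have "\<dots> = C * s powr (real (Suc m) + r)"
      using s by (simp add: powr_add)
    finally show ?thesis .
  qed
  then show ?case using C(1) by blast
qed

text \<open>On a fixed vertical segment with t > 0 the assumed lower bound meets the upper bound C
  s^{\<beta>+\<epsilon>}. Dividing by s^\<beta> leaves K t \<le> C s^\<epsilon>, which fails as s
  tends to 0.\<close>

lemma not_zygmund_holder_loc_of_growth:
  fixes u :: "real \<times> real \<Rightarrow> real"
  assumes U: "open U" "(0, 0) \<in> U" and "0 < \<epsilon>" "0 < K"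
    and zero: "\<And>x y. y \<le> 0 \<Longrightarrow> u (x, y) = 0"
    and growth: "\<And>x y. 0 \<le> x \<Longrightarrow> 0 < y \<Longrightarrow> y \<le> 1 \<Longrightarrow> K * x * y powr \<beta> \<le> u (x, y)"
  shows "\<not> zygmund_holder_loc (\<beta> + \<epsilon>) U u"
proof
  assume "zygmund_holder_loc (\<beta> + \<epsilon>) U u"
  then obtain c e m r where ce: "(0, 0) \<in> ball c e" and mr: "\<beta> + \<epsilon> = real m + r" "0 < r" "r \<le> 1"
    and zh: "zh_class m r (ball c e) u"
    using U unfolding zygmund_holder_loc_def zygmund_holder_def by meson
  obtain \<delta> where \<delta>: "0 < \<delta>" "ball (0, 0) \<delta> \<subseteq> ball c e"
    using ce open_contains_ball[of "ball c e"] open_ball[of c e] by blast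
  \<comment> \<open>The ball \<open>ball c e\<close> need not be centred at the origin, hence
    \<delta>. With |t| + |s| \<le> \<delta>/2 the segment stays inside, and the cap 1 keeps s in the
    range of \<open>growth\<close>.\<close>
  define t where "t = min 1 (\<delta> / 4)"
  have t: "0 < t" "t \<le> 1" "t \<le> \<delta> / 4" using \<delta> by (auto simp: t_def)
  have seg: "(t, s) \<in> ball c e" if "\<bar>s\<bar> \<le> t" for s
  proof -
    have "norm (t, s) \<le> \<bar>t\<bar> + \<bar>s\<bar>"
      using norm_Pair_le[of t s] by simp
    also have "\<dots> < \<delta>" using t that \<delta> by simp
    finally show ?thesis
      using \<delta>(2) by (auto simp: dist_norm subset_iff norm_Pair)
  qed
  obtain C where C: "0 \<le> C" "\<And>s. 0 < s \<Longrightarrow> s \<le> t \<Longrightarrow> \<bar>u (t, s)\<bar> \<le> C * s powr (\<beta> + \<epsilon>)"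
    using zh_class_vanishing_imp_growth[OF zh mr(2,3) zero t(1) seg] mr(1) by auto
  have "K * t \<le> C * s powr \<epsilon>" if s: "0 < s" "s \<le> t" for s
  proof -
    have "K * t * s powr \<beta> \<le> u (t, s)"
      using growth[of t s] s t by auto
    also have "\<dots> \<le> C * s powr (\<beta> + \<epsilon>)"
      using C(2)[OF s] by auto
    finally have "K * t * s powr \<beta> \<le> C * s powr \<epsilon> * s powr \<beta>"
      by (simp add: powr_add mult_ac)
    then show ?thesis using s by simp
  qed
  then have "\<forall>\<^sub>F s in at_right 0. K * t \<le> C * s powr \<epsilon>"
    using t by (auto simp: eventually_at_right_field intro!: exI[of _ t])
  moreover have "((\<lambda>s. C * s powr \<epsilon>) \<longlongrightarrow> C * 0) (at_right 0)"
    using assms(3)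
    by (intro tendsto_mult tendsto_const tendsto_zero_powrI[where b = \<epsilon>])
      (auto simp: eventually_at_filter)
  ultimately have "K * t \<le> C * 0"
    by (intro tendsto_lowerbound) auto
  moreover have "0 < K * t" using assms(4) t by simp
  ultimately show False by simp
qed

theorem lemma8p6:
  fixes \<alpha> :: real
    and f :: "real \<Rightarrow> real"
    and X Y :: "real \<times> real \<Rightarrow> real \<times> real"
    and \<Phi> :: "real \<times> real \<Rightarrow> real \<times> real"
  assumes "\<alpha> > 1"
    and "f = (\<lambda>y. \<alpha> * max 0 y powr (\<alpha> - 1))"
    and "X = (\<lambda>(x, y). (1, 0))"
    and "Y = (\<lambda>(x, y). (x * f y, 1))"
    and "\<Phi> = (\<lambda>(t, s). exp_field (\<lambda>p. t *\<^sub>R X p + s *\<^sub>R Y p) (0, 0))"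
  shows "(\<exists>\<A>. zh_atlas (\<alpha> + 1) \<A> \<and> compatible_with_standard \<alpha> \<A> \<and>
              zh_field_wrt \<alpha> \<A> X \<and> zh_field_wrt \<alpha> \<A> Y) \<and>
         (\<exists>U. open U \<and> (0, 0) \<in> U \<and>
              (\<forall>(t, s)\<in>U. \<exists>!q. flows_to (\<lambda>p. t *\<^sub>R X p + s *\<^sub>R Y p) (0, 0) q) \<and>
              C1_diffeo_on U \<Phi>) \<and>
         (\<forall>\<epsilon>>0. \<not> (\<exists>U. open U \<and> (0, 0) \<in> U \<and>
              zh_loc_map (\<alpha> - 1 + \<epsilon>) U (pullback_field \<Phi> Y))) \<and>
         (\<forall>\<epsilon>>0. \<not> (\<exists>U. open U \<and> (0, 0) \<in> U \<and>
              zh_loc_map (\<alpha> - 1 + \<epsilon>) U (pullback_field \<Phi> X) \<and>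
              zh_loc_map (\<alpha> - 1 + \<epsilon>) U (pullback_field \<Phi> Y)))"
proof -
  note \<alpha> = assms(1)
  have Y: "Y = (\<lambda>(x, y). (x * (\<alpha> * pos_pow (\<alpha> - 1) y), 1))"
    by (simp add: assms(2,4) pos_pow_def)
  have "(\<lambda>p. t *\<^sub>R X p + s *\<^sub>R Y p) = (\<lambda>(x, y). (t + s * (x * (\<alpha> * pos_pow (\<alpha> - 1) y)), s))" for t s
    by (auto simp: Y assms(3))
  then have flow: "flows_to (\<lambda>p. t *\<^sub>R X p + s *\<^sub>R Y p) (0, 0) q \<longleftrightarrow> q = flow_endpoint \<alpha> (t, s)" for t s q
    using flows_to_iff[OF \<alpha>] by simp
  have \<Phi>: "\<Phi> = flow_endpoint \<alpha>"
    by (auto simp: assms(5) exp_field_def flow)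
  have atlas: "\<exists>\<A>. zh_atlas (\<alpha> + 1) \<A> \<and> compatible_with_standard \<alpha> \<A> \<and>
      zh_field_wrt \<alpha> \<A> X \<and> zh_field_wrt \<alpha> \<A> Y"
    using zh_atlas_straightening[OF \<alpha>] compatible_with_standard_straightening[OF \<alpha>]
      zh_field_wrt_straightening[OF \<alpha>] unfolding assms(2,3,4) by blast
  \<comment> \<open>The explicit formulas are global, so the whole plane serves as the
    neighbourhood.\<close>
  have diffeo: "\<exists>U. open U \<and> (0, 0) \<in> U \<and>
      (\<forall>(t, s)\<in>U. \<exists>!q. flows_to (\<lambda>p. t *\<^sub>R X p + s *\<^sub>R Y p) (0, 0) q) \<and> C1_diffeo_on U \<Phi>"
    using C1_diffeo_on_flow_endpoint[OF \<alpha>] by (intro exI[of _ UNIV]) (auto simp: flow \<Phi>)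
  \<comment> \<open>The other component of the pulled back field is the constant 1, so the failure
    of regularity has to be found here.\<close>
  define u where "u p = pullback_field \<Phi> Y p \<bullet> (1, 0)" for p
  have u: "u (t, s) = t * (- damping' \<alpha> s / damping \<alpha> s)" for t s
    by (simp add: u_def \<Phi> Y pullback_flow_endpoint[OF \<alpha>])
  have growth: "\<alpha> * exp (- 1) / (\<alpha> + 1) * t * s powr (\<alpha> - 1) \<le> u (t, s)"
    if "0 \<le> t" "0 < s" "s \<le> 1" for t s
  proof -
    have "\<alpha> * exp (- 1) / (\<alpha> + 1) * s powr (\<alpha> - 1) \<le> - damping' \<alpha> s"
      using damping'_le[OF \<alpha>, of s] that by simp
    \<comment> \<open>Dividing the nonnegative number -h'(s) by h(s), which lies in (0,1], can only
      increase it.\<close>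
    also have "\<dots> \<le> - damping' \<alpha> s / damping \<alpha> s"
    proof -
      have "0 \<le> \<alpha> * exp (- 1) / (\<alpha> + 1) * s powr (\<alpha> - 1)"
        using \<alpha> by simp
      then have "0 \<le> - damping' \<alpha> s"
        using damping'_le[OF \<alpha>, of s] that by simp
      then have "- damping' \<alpha> s * damping \<alpha> s \<le> - damping' \<alpha> s"
        using damping_bounds(2)[OF \<alpha>, of s] by (intro mult_left_le)
      then show ?thesis
        using damping_bounds(1)[OF \<alpha>, of s] by (subst pos_le_divide_eq)
    qed
    finally have "t * (\<alpha> * exp (- 1) / (\<alpha> + 1) * s powr (\<alpha> - 1)) \<le> u (t, s)"
      unfolding u using that by (intro mult_left_mono)
    then show ?thesis by (simp add: mult_ac)
  qed
  have irregular: "\<not> zh_loc_map (\<alpha> - 1 + \<epsilon>) U (pullback_field \<Phi> Y)"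
    if "0 < \<epsilon>" "open U" "(0, 0) \<in> U" for \<epsilon> U
  proof
    assume "zh_loc_map (\<alpha> - 1 + \<epsilon>) U (pullback_field \<Phi> Y)"
    then have "zygmund_holder_loc (\<alpha> - 1 + \<epsilon>) U u"
      by (auto simp: zh_loc_map_def u_def[abs_def] Basis_prod_def)
    moreover have "\<not> zygmund_holder_loc (\<alpha> - 1 + \<epsilon>) U u"
      by (rule not_zygmund_holder_loc_of_growth[OF that(2,3,1) _ _ growth])
        (use \<alpha> in \<open>auto simp: u damping'_nonpos\<close>)
    ultimately show False by blast
  qed
  \<comment> \<open>Irregularity of the pair follows from that of \<Phi>^*Y alone.\<close>
  show ?thesis
    using atlas diffeo irregular by blast
qed

end
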